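(* Let $X$ be a Lindelöf space and let $\kappa<\mathfrak{d}$ be a cardinal. (1) If $X$ is a union of $\kappa$ many subspaces each of which is weakly Hurewicz in the sense of Sakai, then $X$ is weakly Scheepers (in the sense of Sakai). (2) If $X$ is a union of $\kappa$ many subspaces each of which is weakly Hurewicz in the sense of Kočinac, then $X$ is weakly Scheepers in the sense of Kočinac.
   Context: Lindelöf means that every open cover has a countable subcover (no separation axiom is assumed). For a topological space $Z$, in each item below the condition is required for every sequence $(\mathcal{U}_n)_{n\in\mathbb{N}}$ of open covers of $Z$. $Z$ is weakly Hurewicz in the sense of Sakai if there are finite $\mathcal{V}_n\subseteq\mathcal{U}_n$ such that for every nonempty open $U\subseteq Z$, $U\cap\left(\bigcup\mathcal{V}_n\right)\neq\emptyset$ for all but finitely many $n$. $Z$ is weakly Hurewicz in the sense of Kočinac if there are a dense set $Y\subseteq Z$ and finite $\mathcal{V}_n\subseteq\mathcal{U}_n$ such that each $x\in Y$ belongs to $\bigcup\mathcal{V}_n$ for all but finitely many $n$. $Z$ is weakly Scheepers (in the sense of Sakai) if there are finite $\mathcal{V}_n\subseteq\mathcal{U}_n$ such that for every finite collection $\mathcal{F}$ of nonempty open subsets of $Z$ there is an $n$ with $U\cap\left(\bigcup\mathcal{V}_n\right)\neq\emptyset$ for all $U\in\mathcal{F}$. $Z$ is weakly Scheepers in the sense of Kočinac if there are a dense set $Y\subseteq Z$ and finite $\mathcal{V}_n\subseteq\mathcal{U}_n$ such that every finite set $F\subseteq Y$ is contained in $\bigcup\mathcal{V}_n$ for some $n$.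 For $f,g\in\mathbb{N}^{\mathbb{N}}$ write $f\leq^* g$ if $f(n)\leq g(n)$ for all but finitely many $n$. A set $D\subseteq\mathbb{N}^{\mathbb{N}}$ is dominating if for each $g\in\mathbb{N}^{\mathbb{N}}$ there is $f\in D$ with $g\leq^* f$; $\mathfrak{d}$ is the minimum cardinality of a dominating subset of $\mathbb{N}^{\mathbb{N}}$. *)

theory Defs
  imports "HOL-Analysis.Analysis"
begin

unbundle cardinal_syntax

definition open_cover_of :: "'a topology \<Rightarrow> 'a set set \<Rightarrow> bool" where
  "open_cover_of Z \<U> \<longleftrightarrow> (\<forall>U\<in>\<U>. openin Z U) \<and> \<Union>\<U> = topspace Z"

definition dense_in_space :: "'a topology \<Rightarrow> 'a set \<Rightarrow> bool" where
  "dense_in_space Z Y \<longleftrightarrow> Y \<subseteq> topspace Z \<and> Z closure_of Y = topspace Z"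

(* MOST n, the dual of INFM n, reads "for all but finitely many n". *)

definition weakly_Hurewicz_Sakai :: "'a topology \<Rightarrow> bool" where
  "weakly_Hurewicz_Sakai Z \<longleftrightarrow>
     (\<forall>\<U> :: nat \<Rightarrow> 'a set set. (\<forall>n. open_cover_of Z (\<U> n)) \<longrightarrow>
       (\<exists>\<V>. (\<forall>n. finite (\<V> n) \<and> \<V> n \<subseteq> \<U> n) \<and>
            (\<forall>U. openin Z U \<and> U \<noteq> {} \<longrightarrow> (MOST n. U \<inter> \<Union>(\<V> n) \<noteq> {}))))"

definition weakly_Hurewicz_Kocinac :: "'a topology \<Rightarrow> bool" where
  "weakly_Hurewicz_Kocinac Z \<longleftrightarrow>
     (\<forall>\<U> :: nat \<Rightarrow> 'a set set. (\<forall>n. open_cover_of Z (\<U> n)) \<longrightarrow>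
       (\<exists>Y \<V>. dense_in_space Z Y \<and> (\<forall>n. finite (\<V> n) \<and> \<V> n \<subseteq> \<U> n) \<and>
            (\<forall>x\<in>Y. MOST n. x \<in> \<Union>(\<V> n))))"

definition weakly_Scheepers_Sakai :: "'a topology \<Rightarrow> bool" where
  "weakly_Scheepers_Sakai Z \<longleftrightarrow>
     (\<forall>\<U> :: nat \<Rightarrow> 'a set set. (\<forall>n. open_cover_of Z (\<U> n)) \<longrightarrow>
       (\<exists>\<V>. (\<forall>n. finite (\<V> n) \<and> \<V> n \<subseteq> \<U> n) \<and>
            (\<forall>\<F>. finite \<F> \<and> (\<forall>U\<in>\<F>. openin Z U \<and> U \<noteq> {}) \<longrightarrow>
                 (\<exists>n. \<forall>U\<in>\<F>. U \<inter> \<Union>(\<V> n) \<noteq> {}))))"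

definition weakly_Scheepers_Kocinac :: "'a topology \<Rightarrow> bool" where
  "weakly_Scheepers_Kocinac Z \<longleftrightarrow>
     (\<forall>\<U> :: nat \<Rightarrow> 'a set set. (\<forall>n. open_cover_of Z (\<U> n)) \<longrightarrow>
       (\<exists>Y \<V>. dense_in_space Z Y \<and> (\<forall>n. finite (\<V> n) \<and> \<V> n \<subseteq> \<U> n) \<and>
            (\<forall>F. finite F \<and> F \<subseteq> Y \<longrightarrow> (\<exists>n. F \<subseteq> \<Union>(\<V> n)))))"

definition eventually_le :: "(nat \<Rightarrow> nat) \<Rightarrow> (nat \<Rightarrow> nat) \<Rightarrow> bool" where
  "eventually_le f g \<longleftrightarrow> (MOST n. f n \<le> g n)"

definition dominating :: "(nat \<Rightarrow> nat) set \<Rightarrow> bool" where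
  "dominating D \<longleftrightarrow> (\<forall>g. \<exists>f\<in>D. eventually_le g f)"

(* Cardinals are cardinal orders (relations), so the minimum is one with respect to \<le>o and is
   unique only up to =o; the lemmas below show that the choice is well defined. *)
definition dominating_number :: "(nat \<Rightarrow> nat) rel" where
  "dominating_number =
     (SOME r. (\<exists>D. dominating D \<and> r = |D| ) \<and> (\<forall>E. dominating E \<longrightarrow> r \<le>o |E| ))"

lemma dominating_UNIV: "dominating UNIV"
proof -
  have "eventually_le g g" for g
    unfolding eventually_le_def by (rule MOST_I) simp
  then show ?thesis
    unfolding dominating_def by blast
qed

lemma dominating_number_minimum:
  "(\<exists>D. dominating D \<and> dominating_number = |D| ) \<and>
   (\<forall>E. dominating E \<longrightarrow> dominating_number \<le>o |E| )"
proof -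
  let ?R = "card_of ` Collect dominating"
  have "?R \<noteq> {}"
    using dominating_UNIV by auto
  moreover have "\<forall>r\<in>?R. Card_order r"
    by (simp add: card_of_Card_order)
  ultimately obtain r where r: "r \<in> ?R" "\<forall>r'\<in>?R. r \<le>o r'"
    using exists_minim_Card_order[of ?R] by (auto simp only:)
  have "(\<exists>D. dominating D \<and> r = |D| ) \<and> (\<forall>E. dominating E \<longrightarrow> r \<le>o |E| )"
    using r by auto
  then show ?thesis
    unfolding dominating_number_def by (rule someI)
qed

lemma Card_order_dominating_number: "Card_order dominating_number"
proof -
  obtain D where D: "dominating_number = |D|"
    using dominating_number_minimum by blast
  show ?thesis
    unfolding D by (rule card_of_Card_order)
qed

end

theory Submission
  imports Defs
begin

text \<open>
  By the Lindelof property each cover may be taken countable, so that finite subfamilies of the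
  \<open>n\<close>-th cover amount to bounds on an index. The weak Hurewicz property of the \<open>i\<close>-th piece then
  yields a function \<open>f i\<close>. There are fewer than \<open>\<dd>\<close> finite sums of the \<open>f i\<close>, hence
  some \<open>g\<close> is infinitely often above each such sum, and \<open>g\<close> determines the finite
  subfamilies that witness the weak Scheepers property of the union.
\<close>

section \<open>Finite subsets and the dominating number\<close>

lemma card_of_Fpow_ordLeq_infinite:
  assumes "infinite A"
  shows "|Fpow A| \<le>o |A|"
proof -
  \<comment> \<open>Stratify by size: inserting one more element maps \<open>A \<times> B n\<close>
    onto a superset of \<open>B (Suc n)\<close>, so by induction each layer is at most
    \<open>|A|\<close>. There are only countably many layers, and \<open>A\<close> is
    infinite.\<close>
  define B where "B n = {F. F \<subseteq> A \<and> finite F \<and> card F = n}" for n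
  have "|B n| \<le>o |A|" for n
  proof (induction n)
    case 0
    have "B 0 = {{}}"
      by (auto simp: B_def)
    then show ?case
      using assms by (auto intro: card_of_singl_ordLeq)
  next
    case (Suc n)
    have "B (Suc n) \<subseteq> (\<lambda>(a, F). insert a F) ` (A \<times> B n)"
    proof
      fix F assume "F \<in> B (Suc n)"
      then obtain a G where "F = insert a G" "a \<notin> G" "card G = n" "F \<subseteq> A" "finite F"
        by (auto simp: B_def card_Suc_eq)
      then show "F \<in> (\<lambda>(a, F). insert a F) ` (A \<times> B n)"
        by (intro image_eqI[of _ _ "(a, G)"]) (auto simp: B_def)
    qed
    then have "|B (Suc n)| \<le>o |A \<times> B n|"
      using card_of_mono1 card_of_image ordLeq_transitive by blast
    moreover have "|A \<times> B n| \<le>o |A|"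
      using assms Suc by (intro card_of_Sigma_ordLeq_infinite) (auto intro: card_of_mono1)
    ultimately show ?case
      by (rule ordLeq_transitive)
  qed
  moreover have "|UNIV :: nat set| \<le>o |A|"
    using assms infinite_iff_card_of_nat by blast
  ultimately have "|\<Union>n. B n| \<le>o |A|"
    using assms by (intro card_of_UNION_ordLeq_infinite) auto
  moreover have "Fpow A = (\<Union>n. B n)"
    by (auto simp: Fpow_def B_def)
  ultimately show ?thesis
    by simp
qed

text \<open>Handling each \<open>f i\<close> separately would give infinite sets of indices that
  need not meet. Passing to finite sums makes one index serve all of \<open>F\<close>, and for
  infinite \<open>I\<close> there are no more finite sums than elements of \<open>I\<close>, so they
  still cannot dominate.\<close>

lemma ex_infinitely_often_above:
  fixes f :: "'i \<Rightarrow> nat \<Rightarrow> nat"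
  assumes "|I| <o dominating_number"
  obtains g where "\<And>F. finite F \<Longrightarrow> F \<subseteq> I \<Longrightarrow> INFM n. \<forall>i\<in>F. f i n \<le> g n"
proof (cases "finite I")
  case True
  show thesis
  proof (rule that)
    fix F assume F: "finite F" "F \<subseteq> I"
    have "\<forall>i\<in>F. f i n \<le> (\<Sum>i\<in>I. f i n)" for n
      using True F by (auto intro!: member_le_sum)
    then show "INFM n. \<forall>i\<in>F. f i n \<le> (\<Sum>i\<in>I. f i n)"
      by simp
  qed
next
  case False
  define h where "h F = (\<lambda>n. \<Sum>i\<in>F. f i n)" for F
  have "|h ` Fpow I| \<le>o |I|"
    using card_of_image[of h "Fpow I"] card_of_Fpow_ordLeq_infinite[OF False]
    by (rule ordLeq_transitive)
  then have "|h ` Fpow I| <o dominating_number"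
    using assms by (rule ordLeq_ordLess_trans)
  then have "\<not> dominating (h ` Fpow I)"
    using dominating_number_minimum not_ordLess_ordLeq by blast
  then obtain g where g: "\<And>F. F \<in> Fpow I \<Longrightarrow> \<not> eventually_le g (h F)"
    unfolding dominating_def by blast
  show thesis
  proof (rule that)
    fix F assume F: "finite F" "F \<subseteq> I"
    then have "INFM n. h F n < g n"
      using g[of F] unfolding Fpow_def eventually_le_def not_MOST not_le by blast
    then show "INFM n. \<forall>i\<in>F. f i n \<le> g n"
    proof (rule INFM_mono)
      fix n assume "h F n < g n"
      moreover have "f i n \<le> h F n" if "i \<in> F" for i
        unfolding h_def using that F(1) by (intro member_le_sum) auto
      ultimately show "\<forall>i\<in>F. f i n \<le> g n"
        by (meson order_trans less_imp_le)
    qed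
  qed
qed

text \<open>Enumerating \<open>C n\<close> turns inclusion between finite subfamilies into
  inequality between numbers: \<open>V n\<close> consists of the members with index up to
  \<open>g n\<close>.\<close>

lemma ex_finite_infinitely_often_supset:
  fixes C :: "nat \<Rightarrow> 'a set" and W :: "'i \<Rightarrow> nat \<Rightarrow> 'a set"
  assumes "|I| <o dominating_number"
    and "\<And>n. countable (C n)"
    and "\<And>i n. i \<in> I \<Longrightarrow> finite (W i n) \<and> W i n \<subseteq> C n"
  obtains V where "\<And>n. finite (V n) \<and> V n \<subseteq> C n"
    and "\<And>F. finite F \<Longrightarrow> F \<subseteq> I \<Longrightarrow> INFM n. \<forall>i\<in>F. W i n \<subseteq> V n"
proof -
  let ?ix = "\<lambda>n. to_nat_on (C n)"
  \<comment> \<open>The sum serves as an upper bound for the indices; unlike a maximum, it is also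
    defined when \<open>W i n\<close> is empty.\<close>
  define f where "f i n = (\<Sum>U\<in>W i n. ?ix n U)" for i n
  obtain g where g: "\<And>F. finite F \<Longrightarrow> F \<subseteq> I \<Longrightarrow> INFM n. \<forall>i\<in>F. f i n \<le> g n"
    using ex_infinitely_often_above[OF assms(1)] by blast
  define V where "V n = {U \<in> C n. ?ix n U \<le> g n}" for n
  show thesis
  proof (rule that)
    fix n
    have "inj_on (?ix n) (V n)"
      using inj_on_to_nat_on[OF assms(2)] by (rule inj_on_subset) (auto simp: V_def)
    moreover have "finite (?ix n ` V n)"
      by (rule finite_subset[of _ "{..g n}"]) (auto simp: V_def)
    ultimately show "finite (V n) \<and> V n \<subseteq> C n"
      by (auto simp: V_def finite_image_iff)
  next
    fix F assume F: "finite F" "F \<subseteq> I"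
    show "INFM n. \<forall>i\<in>F. W i n \<subseteq> V n"
      using g[OF F]
    proof (rule INFM_mono)
      fix n assume *: "\<forall>i\<in>F. f i n \<le> g n"
      have "U \<in> V n" if "i \<in> F" "U \<in> W i n" for i U
      proof -
        have W: "finite (W i n)" "W i n \<subseteq> C n"
          using assms(3) F that by blast+
        have "?ix n U \<le> f i n"
          unfolding f_def using W that by (auto intro!: member_le_sum)
        then show ?thesis
          using * that W unfolding V_def by force
      qed
      then show "\<forall>i\<in>F. W i n \<subseteq> V n"
        by blast
    qed
  qed
qed

section \<open>Countable subcovers and traces on subspaces\<close>

lemma Lindelof_space_countable_subcovers:
  fixes \<U> :: "nat \<Rightarrow> 'a set set"
  assumes "Lindelof_space X" "\<And>n. open_cover_of X (\<U> n)"
  obtains C where "\<And>n. countable (C n)" "\<And>n. C n \<subseteq> \<U> n" "\<And>n. open_cover_of X (C n)"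
proof -
  have "\<exists>C. countable C \<and> C \<subseteq> \<U> n \<and> open_cover_of X C" for n
    using assms unfolding Lindelof_space_def open_cover_of_def by (metis subsetD)
  then show thesis
    using that by metis
qed

lemma open_cover_of_subtopology:
  assumes "open_cover_of X C"
  shows "open_cover_of (subtopology X S) ((\<lambda>U. S \<inter> U) ` C)"
  using assms unfolding open_cover_of_def
  by (auto intro!: openin_subtopology_Int2)

text \<open>Different members of \<open>C n\<close> may have the same trace on \<open>S\<close>, so
  one preimage is chosen for each selected trace; this keeps the lifted family finite.\<close>

lemma finite_traces_lift:
  fixes \<V> :: "nat \<Rightarrow> 'a set set"
  assumes "\<And>n. finite (\<V> n) \<and> \<V> n \<subseteq> (\<lambda>U. S \<inter> U) ` C n"
  obtains W where "\<And>n. finite (W n) \<and> W n \<subseteq> C n" "\<And>n. \<Union>(\<V> n) = S \<inter> \<Union>(W n)"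
proof -
  have "\<exists>W. W \<subseteq> C n \<and> finite W \<and> \<V> n = (\<lambda>U. S \<inter> U) ` W" for n
    using assms finite_subset_image by metis
  then obtain W where W: "\<And>n. W n \<subseteq> C n \<and> finite (W n) \<and> \<V> n = (\<lambda>U. S \<inter> U) ` W n"
    by metis
  show thesis
  proof (rule that)
    show "\<Union>(\<V> n) = S \<inter> \<Union>(W n)" for n
      using W by auto
  qed (use W in blast)
qed

text \<open>This lets all pieces select from the same families \<open>C n\<close>, so that their
  selections can be compared. A set \<open>U\<close> open in the whole space is tested through
  \<open>U \<inter> S\<close>, a nonempty open set of the subspace.\<close>

lemma weakly_Hurewicz_Sakai_subtopologyD:
  fixes C :: "nat \<Rightarrow> 'a set set"
  assumes "weakly_Hurewicz_Sakai (subtopology X S)" "\<And>n. open_cover_of X (C n)"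
  obtains W where "\<And>n. finite (W n) \<and> W n \<subseteq> C n"
    and "\<And>U. openin X U \<Longrightarrow> U \<inter> S \<noteq> {} \<Longrightarrow> MOST n. U \<inter> \<Union>(W n) \<noteq> {}"
proof -
  have traces: "\<forall>n. open_cover_of (subtopology X S) ((\<lambda>U. S \<inter> U) ` C n)"
    using assms(2) open_cover_of_subtopology by blast
  obtain \<V> where fin: "\<And>n. finite (\<V> n) \<and> \<V> n \<subseteq> (\<lambda>U. S \<inter> U) ` C n"
    and V: "\<And>U. openin (subtopology X S) U \<Longrightarrow> U \<noteq> {} \<Longrightarrow> MOST n. U \<inter> \<Union>(\<V> n) \<noteq> {}"
    using assms(1)[unfolded weakly_Hurewicz_Sakai_def, THEN spec, THEN mp, OF traces] by metis
  obtain W where W: "\<And>n. finite (W n) \<and> W n \<subseteq> C n" "\<And>n. \<Union>(\<V> n) = S \<inter> \<Union>(W n)"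
    using finite_traces_lift[of \<V> S C, OF fin] by blast
  show thesis
  proof (rule that[OF W(1)])
    fix U assume "openin X U" "U \<inter> S \<noteq> {}"
    then have "MOST n. (U \<inter> S) \<inter> \<Union>(\<V> n) \<noteq> {}"
      by (intro V openin_subtopology_Int)
    then show "MOST n. U \<inter> \<Union>(W n) \<noteq> {}"
      by (rule MOST_mono) (auto simp: W(2))
  qed
qed

lemma weakly_Hurewicz_Kocinac_subtopologyD:
  fixes C :: "nat \<Rightarrow> 'a set set"
  assumes "weakly_Hurewicz_Kocinac (subtopology X S)" "\<And>n. open_cover_of X (C n)"
  obtains Y W where "dense_in_space (subtopology X S) Y"
    and "\<And>n. finite (W n) \<and> W n \<subseteq> C n" "\<And>x. x \<in> Y \<Longrightarrow> MOST n. x \<in> \<Union>(W n)"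
proof -
  have traces: "\<forall>n. open_cover_of (subtopology X S) ((\<lambda>U. S \<inter> U) ` C n)"
    using assms(2) open_cover_of_subtopology by blast
  obtain Y \<V> where Y: "dense_in_space (subtopology X S) Y"
    and fin: "\<And>n. finite (\<V> n) \<and> \<V> n \<subseteq> (\<lambda>U. S \<inter> U) ` C n"
    and V: "\<And>x. x \<in> Y \<Longrightarrow> MOST n. x \<in> \<Union>(\<V> n)"
    using assms(1)[unfolded weakly_Hurewicz_Kocinac_def, THEN spec, THEN mp, OF traces] by metis
  obtain W where W: "\<And>n. finite (W n) \<and> W n \<subseteq> C n" "\<And>n. \<Union>(\<V> n) = S \<inter> \<Union>(W n)"
    using finite_traces_lift[of \<V> S C, OF fin] by blast
  show thesis
  proof (rule that[OF Y W(1)])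
    fix x assume "x \<in> Y"
    then show "MOST n. x \<in> \<Union>(W n)"
      by (rule MOST_mono[OF V]) (auto simp: W(2))
  qed
qed

text \<open>Closure in a subspace is contained in closure in \<open>X\<close>, so each
  \<open>S i\<close> lies in the closure of \<open>Y i\<close> in \<open>X\<close>, hence in that of
  the union.\<close>

lemma dense_in_space_Union:
  assumes "topspace X = (\<Union>i\<in>I. S i)"
    and "\<And>i. i \<in> I \<Longrightarrow> dense_in_space (subtopology X (S i)) (Y i)"
  shows "dense_in_space X (\<Union>i\<in>I. Y i)"
proof -
  have "x \<in> X closure_of (\<Union>i\<in>I. Y i)" if "i \<in> I" "x \<in> S i" for i x
  proof -
    have "x \<in> subtopology X (S i) closure_of Y i"
      using assms that unfolding dense_in_space_def by auto
    then have "x \<in> X closure_of Y i"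
      by (auto simp: closure_of_subtopology intro: subsetD[OF closure_of_mono])
    then show ?thesis
      using closure_of_mono[of "Y i" "\<Union>i\<in>I. Y i" X] that by blast
  qed
  moreover have "Y i \<subseteq> topspace X" if "i \<in> I" for i
    using assms(2)[OF that] unfolding dense_in_space_def by auto
  ultimately show ?thesis
    using assms(1) closure_of_subset_topspace[of X "\<Union>i\<in>I. Y i"]
    unfolding dense_in_space_def by blast
qed

section \<open>Unions of weakly Hurewicz subspaces\<close>

theorem weakly_Scheepers_Sakai_Union:
  assumes "Lindelof_space X" "|I| <o dominating_number" "topspace X = (\<Union>i\<in>I. S i)"
    and "\<And>i. i \<in> I \<Longrightarrow> weakly_Hurewicz_Sakai (subtopology X (S i))"
  shows "weakly_Scheepers_Sakai X"
  unfolding weakly_Scheepers_Sakai_def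
proof (intro allI impI)
  fix \<U> :: "nat \<Rightarrow> 'a set set"
  assume "\<forall>n. open_cover_of X (\<U> n)"
  then have "open_cover_of X (\<U> n)" for n
    by blast
  then obtain C where C: "\<And>n. countable (C n)" "\<And>n. C n \<subseteq> \<U> n" "\<And>n. open_cover_of X (C n)"
    using Lindelof_space_countable_subcovers[OF assms(1), of \<U>] by blast
  have "\<forall>i\<in>I. \<exists>W. (\<forall>n. finite (W n) \<and> W n \<subseteq> C n) \<and>
      (\<forall>U. openin X U \<and> U \<inter> S i \<noteq> {} \<longrightarrow> (MOST n. U \<inter> \<Union>(W n) \<noteq> {}))"
    (is "\<forall>i\<in>I. ?P i")
  proof
    fix i assume "i \<in> I"
    show "?P i"
      by (rule weakly_Hurewicz_Sakai_subtopologyD[where C = C, OF assms(4)[OF \<open>i \<in> I\<close>] C(3)]) blast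
  qed
  then obtain W where W: "\<And>i n. i \<in> I \<Longrightarrow> finite (W i n) \<and> W i n \<subseteq> C n"
    and meets: "\<And>i U. i \<in> I \<Longrightarrow> openin X U \<Longrightarrow> U \<inter> S i \<noteq> {} \<Longrightarrow> MOST n. U \<inter> \<Union>(W i n) \<noteq> {}"
    by metis
  obtain V where V: "\<And>n. finite (V n) \<and> V n \<subseteq> C n"
    and sup: "\<And>F. finite F \<Longrightarrow> F \<subseteq> I \<Longrightarrow> INFM n. \<forall>i\<in>F. W i n \<subseteq> V n"
    using ex_finite_infinitely_often_supset[of I C W, OF assms(2) C(1) W] by blast
  have "\<exists>n. \<forall>U\<in>\<F>. U \<inter> \<Union>(V n) \<noteq> {}"
    if \<F>: "finite \<F>" "\<forall>U\<in>\<F>. openin X U \<and> U \<noteq> {}" for \<F>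
  proof -
    have "\<forall>U\<in>\<F>. \<exists>i\<in>I. U \<inter> S i \<noteq> {}"
      using \<F>(2) openin_subset assms(3) by fastforce
    then obtain p where p: "\<forall>U\<in>\<F>. p U \<in> I \<and> U \<inter> S (p U) \<noteq> {}"
      by metis
    have most: "MOST n. \<forall>U\<in>\<F>. U \<inter> \<Union>(W (p U) n) \<noteq> {}"
      using \<F> p meets by (simp add: MOST_finite_Ball_distrib)
    have inf: "INFM n. \<forall>i\<in>p ` \<F>. W i n \<subseteq> V n"
      using \<F>(1) p by (intro sup) auto
    \<comment> \<open>A cofinite set of indices meets an infinite one. At a common index the
      selection of each chosen piece meets its open set and is absorbed by
      \<open>V n\<close>.\<close>
    obtain n where n: "\<forall>i\<in>p ` \<F>. W i n \<subseteq> V n" "\<forall>U\<in>\<F>. U \<inter> \<Union>(W (p U) n) \<noteq> {}"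
      using INFM_EX[OF INFM_conjI[OF inf most]] by blast
    have "U \<inter> \<Union>(V n) \<noteq> {}" if "U \<in> \<F>" for U
    proof -
      have "U \<inter> \<Union>(W (p U) n) \<noteq> {}" "W (p U) n \<subseteq> V n"
        using n that by auto
      then show ?thesis
        by blast
    qed
    then show ?thesis
      by (intro exI[of _ n] ballI)
  qed
  then have "\<forall>\<F>. finite \<F> \<and> (\<forall>U\<in>\<F>. openin X U \<and> U \<noteq> {}) \<longrightarrow> (\<exists>n. \<forall>U\<in>\<F>. U \<inter> \<Union>(V n) \<noteq> {})"
    by simp
  moreover have "\<forall>n. finite (V n) \<and> V n \<subseteq> \<U> n"
    using V C(2) by blast
  ultimately show "\<exists>\<V>. (\<forall>n. finite (\<V> n) \<and> \<V> n \<subseteq> \<U> n) \<and>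
      (\<forall>\<F>. finite \<F> \<and> (\<forall>U\<in>\<F>. openin X U \<and> U \<noteq> {}) \<longrightarrow> (\<exists>n. \<forall>U\<in>\<F>. U \<inter> \<Union>(\<V> n) \<noteq> {}))"
    by (intro exI[of _ V] conjI)
qed

theorem weakly_Scheepers_Kocinac_Union:
  assumes "Lindelof_space X" "|I| <o dominating_number" "topspace X = (\<Union>i\<in>I. S i)"
    and "\<And>i. i \<in> I \<Longrightarrow> weakly_Hurewicz_Kocinac (subtopology X (S i))"
  shows "weakly_Scheepers_Kocinac X"
  unfolding weakly_Scheepers_Kocinac_def
proof (intro allI impI)
  fix \<U> :: "nat \<Rightarrow> 'a set set"
  assume "\<forall>n. open_cover_of X (\<U> n)"
  then have "open_cover_of X (\<U> n)" for n
    by blast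
  then obtain C where C: "\<And>n. countable (C n)" "\<And>n. C n \<subseteq> \<U> n" "\<And>n. open_cover_of X (C n)"
    using Lindelof_space_countable_subcovers[OF assms(1), of \<U>] by blast
  have "\<forall>i\<in>I. \<exists>Y W. dense_in_space (subtopology X (S i)) Y \<and>
      (\<forall>n. finite (W n) \<and> W n \<subseteq> C n) \<and> (\<forall>x\<in>Y. MOST n. x \<in> \<Union>(W n))"
    (is "\<forall>i\<in>I. ?P i")
  proof
    fix i assume "i \<in> I"
    show "?P i"
      by (rule weakly_Hurewicz_Kocinac_subtopologyD[where C = C, OF assms(4)[OF \<open>i \<in> I\<close>] C(3)]) blast
  qed
  then obtain Y W where Y: "\<And>i. i \<in> I \<Longrightarrow> dense_in_space (subtopology X (S i)) (Y i)"
    and W: "\<And>i n. i \<in> I \<Longrightarrow> finite (W i n) \<and> W i n \<subseteq> C n"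
    and mem: "\<And>i x. i \<in> I \<Longrightarrow> x \<in> Y i \<Longrightarrow> MOST n. x \<in> \<Union>(W i n)"
    by metis
  obtain V where V: "\<And>n. finite (V n) \<and> V n \<subseteq> C n"
    and sup: "\<And>F. finite F \<Longrightarrow> F \<subseteq> I \<Longrightarrow> INFM n. \<forall>i\<in>F. W i n \<subseteq> V n"
    using ex_finite_infinitely_often_supset[of I C W, OF assms(2) C(1) W] by blast
  have "\<exists>n. F \<subseteq> \<Union>(V n)" if F: "finite F" "F \<subseteq> (\<Union>i\<in>I. Y i)" for F
  proof -
    \<comment> \<open>Now points take the place of open sets: \<open>p\<close> assigns to each point
      of \<open>F\<close> a piece whose dense set contains it, and again an infinite and a cofinite
      set of indices are intersected.\<close>
    obtain p where p: "\<forall>x\<in>F. p x \<in> I \<and> x \<in> Y (p x)"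
      using F(2) by (metis UN_E subsetD)
    have most: "MOST n. \<forall>x\<in>F. x \<in> \<Union>(W (p x) n)"
      using F p mem by (simp only: MOST_finite_Ball_distrib) blast
    have inf: "INFM n. \<forall>i\<in>p ` F. W i n \<subseteq> V n"
      using F(1) p by (intro sup) auto
    obtain n where "\<forall>i\<in>p ` F. W i n \<subseteq> V n" "\<forall>x\<in>F. x \<in> \<Union>(W (p x) n)"
      using INFM_EX[OF INFM_conjI[OF inf most]] by blast
    then show ?thesis
      by blast
  qed
  then have "\<forall>F. finite F \<and> F \<subseteq> (\<Union>i\<in>I. Y i) \<longrightarrow> (\<exists>n. F \<subseteq> \<Union>(V n))"
    by simp
  moreover have "\<forall>n. finite (V n) \<and> V n \<subseteq> \<U> n"
    using V C(2) by blast
  moreover have "dense_in_space X (\<Union>i\<in>I. Y i)"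
    using assms(3) Y by (rule dense_in_space_Union)
  ultimately show "\<exists>Y \<V>. dense_in_space X Y \<and> (\<forall>n. finite (\<V> n) \<and> \<V> n \<subseteq> \<U> n) \<and>
      (\<forall>F. finite F \<and> F \<subseteq> Y \<longrightarrow> (\<exists>n. F \<subseteq> \<Union>(\<V> n)))"
    by (intro exI[of _ "\<Union>i\<in>I. Y i"] exI[of _ V] conjI)
qed

text \<open>The cardinal enters through an index set \<open>I\<close>; the family \<open>S\<close>
  need not be injective, so pieces may repeat.\<close>

theorem theorem3p11:
  fixes X :: "'a topology" and \<kappa> :: "'k rel" and I :: "'i set"
  assumes "Lindelof_space X"
    and "Card_order \<kappa>" and "\<kappa> <o dominating_number"
    and "|I| =o \<kappa>"
  shows
    "((\<exists>S :: 'i \<Rightarrow> 'a set. topspace X = (\<Union>i\<in>I. S i) \<and>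
         (\<forall>i\<in>I. weakly_Hurewicz_Sakai (subtopology X (S i))))
       \<longrightarrow> weakly_Scheepers_Sakai X) \<and>
     ((\<exists>S :: 'i \<Rightarrow> 'a set. topspace X = (\<Union>i\<in>I. S i) \<and>
         (\<forall>i\<in>I. weakly_Hurewicz_Kocinac (subtopology X (S i))))
       \<longrightarrow> weakly_Scheepers_Kocinac X)"
proof -
  \<comment> \<open>Cardinals on different types are compared only up to order isomorphism, so the
    bound is carried from \<open>\<kappa>\<close> to \<open>|I|\<close>.\<close>
  have "|I| <o dominating_number"
    using assms(4,3) by (rule ordIso_ordLess_trans)
  then show ?thesis
    using weakly_Scheepers_Sakai_Union[OF assms(1), of I]
      weakly_Scheepers_Kocinac_Union[OF assms(1), of I] by blast
qed

end
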